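(* Let $H\in(0,1)$, $a,k\in\mathbb{R}$, $\sigma>0$, $Y_0>0$, and let $\{B^H_t,t\ge0\}$ be a fractional Brownian motion with Hurst index $H$. Let $Y=\{Y_t,t\ge0\}$ be the process satisfying, until its first hitting of zero, the equation $$dY_t=\frac{1}{2}\left(\frac{k}{Y_t}-aY_t\right)dt+\frac{\sigma}{2}\,dB_t^H,$$ with initial value $Y_0$. Let $\tau:=\inf\{s>0: Y_s=0\}$ and let $X_t:=Y_t^2\,\mathbf{1}_{\{t<\tau\}}$, $t\ge 0$, be the fractional Cox--Ingersoll--Ross process. Then for $0\le t\le\tau$ (with $t<\infty$) the process $X$ satisfies the stochastic differential equation $$dX_t=(k-aX_t)\,dt+\sigma\sqrt{X_t}\circ dB_t^H,\qquad X_0=Y_0^2>0,$$ that is, $$X_t=X_0+\int_0^t(k-aX_s)\,ds+\sigma\int_0^t\sqrt{X_s}\circ dB_s^H ,$$ where the integral with respect to $B^H$ is the pathwise Stratonovich integral (in particular, this integral exists).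
   Context: A fractional Brownian motion with Hurst index $H\in(0,1)$ is a centered Gaussian process $\{B^H_t,t\ge0\}$ with $B^H_0=0$, covariance $\mathbb{E}B^H_tB^H_s=\frac12(t^{2H}+s^{2H}-|t-s|^{2H})$, and continuous paths. That $Y$ satisfies the equation until its first hitting of zero means: $Y$ has continuous paths and, pathwise, for all $0\le t<\tau$, $Y_t>0$ and $Y_t=Y_0+\frac12\int_0^t\left(\frac{k}{Y_s}-aY_s\right)ds+\frac{\sigma}{2}B_t^H$. Here $\inf\emptyset=\infty$. Pathwise Stratonovich integral: for random processes $\{U_t,t\ge0\}$ and $\{V_t,t\ge0\}$, the integral $\int_0^T U_s\circ dV_s$ is the pathwise limit of the sums $$\sum_{i=1}^{n}\frac{U_{t_i}+U_{t_{i-1}}}{2}\,(V_{t_i}-V_{t_{i-1}})$$ as the mesh of the partition $0=t_0<t_1<\cdots<t_n=T$ tends to zero, in case this limit exists. *)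

theory Defs
  imports "HOL-Probability.Probability"
begin

text \<open>Processes are families indexed by the real line of which only the times \<open>t \<ge> 0\<close> matter.
  A Gaussian random variable may be degenerate, i.e. almost surely constant: this is needed
  already for the value of the process at time 0.\<close>

definition gaussian_rv :: "'a measure \<Rightarrow> ('a \<Rightarrow> real) \<Rightarrow> bool" where
  "gaussian_rv M X \<longleftrightarrow> X \<in> borel_measurable M \<and>
     ((\<exists>\<mu> s. 0 < s \<and> distributed M lborel X (normal_density \<mu> s)) \<or>
      (\<exists>\<mu>. AE \<omega> in M. X \<omega> = \<mu>))"

definition gaussian_process :: "'a measure \<Rightarrow> (real \<Rightarrow> 'a \<Rightarrow> real) \<Rightarrow> bool" where
  "gaussian_process M B \<longleftrightarrow> (\<forall>t\<ge>0. B t \<in> borel_measurable M) \<and>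
     (\<forall>I c. finite I \<longrightarrow> I \<subseteq> {0..} \<longrightarrow> gaussian_rv M (\<lambda>\<omega>. \<Sum>t\<in>I. c t * B t \<omega>))"

definition fractional_brownian_motion ::
  "'a measure \<Rightarrow> real \<Rightarrow> (real \<Rightarrow> 'a \<Rightarrow> real) \<Rightarrow> bool" where
  "fractional_brownian_motion M H B \<longleftrightarrow>
     prob_space M \<and> 0 < H \<and> H < 1 \<and>
     gaussian_process M B \<and>
     (\<forall>t\<ge>0. integral\<^sup>L M (B t) = 0) \<and>
     (\<forall>t\<ge>0. \<forall>s\<ge>0. integral\<^sup>L M (\<lambda>\<omega>. B t \<omega> * B s \<omega>)
        = 1/2 * (t powr (2*H) + s powr (2*H) - \<bar>t - s\<bar> powr (2*H))) \<and>
     (\<forall>\<omega>\<in>space M. B 0 \<omega> = 0) \<and>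
     (\<forall>\<omega>\<in>space M. continuous_on {0..} (\<lambda>t. B t \<omega>))"

definition zero_hitting_time :: "(real \<Rightarrow> 'a \<Rightarrow> real) \<Rightarrow> 'a \<Rightarrow> ereal" where
  "zero_hitting_time Y \<omega> = Inf (ereal ` {s. 0 < s \<and> Y s \<omega> = 0})"

text \<open>The drift integrand below is continuous on the interval of integration (as \<open>Y\<close> is continuous
  and positive there), so the integral is never the default value of a non-integrable function.\<close>

definition solves_until_zero ::
  "'a measure \<Rightarrow> real \<Rightarrow> real \<Rightarrow> real \<Rightarrow> real \<Rightarrow> (real \<Rightarrow> 'a \<Rightarrow> real) \<Rightarrow> (real \<Rightarrow> 'a \<Rightarrow> real) \<Rightarrow> bool"
  where
  "solves_until_zero M k a \<sigma> y\<^sub>0 B Y \<longleftrightarrow>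
     (\<forall>t\<ge>0. Y t \<in> borel_measurable M) \<and>
     (\<forall>\<omega>\<in>space M.
        Y 0 \<omega> = y\<^sub>0 \<and>
        continuous_on {0..} (\<lambda>t. Y t \<omega>) \<and>
        (\<forall>t\<ge>0. ereal t < zero_hitting_time Y \<omega> \<longrightarrow>
           0 < Y t \<omega> \<and>
           Y t \<omega> = Y 0 \<omega> + 1/2 * integral {0..t} (\<lambda>s. k / Y s \<omega> - a * Y s \<omega>)
             + \<sigma>/2 * B t \<omega>))"

definition fractional_CIR :: "(real \<Rightarrow> 'a \<Rightarrow> real) \<Rightarrow> real \<Rightarrow> 'a \<Rightarrow> real" where
  "fractional_CIR Y t \<omega> = (Y t \<omega>)\<^sup>2 * of_bool (ereal t < zero_hitting_time Y \<omega>)"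

text \<open>A partition \<open>0 = p 0 < \<dots> < p n = T\<close>. For \<open>T = 0\<close> the only one has \<open>n = 0\<close>, so that
  integrals over the degenerate interval are \<open>0\<close>.\<close>

definition is_partition :: "real \<Rightarrow> nat \<Rightarrow> (nat \<Rightarrow> real) \<Rightarrow> bool" where
  "is_partition T n p \<longleftrightarrow> p 0 = 0 \<and> p n = T \<and> (\<forall>i<n. p i < p (Suc i))"

definition has_stratonovich_integral ::
  "(real \<Rightarrow> real) \<Rightarrow> (real \<Rightarrow> real) \<Rightarrow> real \<Rightarrow> real \<Rightarrow> bool" where
  "has_stratonovich_integral U V T I \<longleftrightarrow>
     (\<forall>\<epsilon>>0. \<exists>\<delta>>0. \<forall>n p. is_partition T n p \<longrightarrow> (\<forall>i<n. p (Suc i) - p i < \<delta>) \<longrightarrow>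
        \<bar>(\<Sum>i=1..n. (U (p i) + U (p (i - 1))) / 2 * (V (p i) - V (p (i - 1)))) - I\<bar> < \<epsilon>)"

definition stratonovich_integrable ::
  "(real \<Rightarrow> real) \<Rightarrow> (real \<Rightarrow> real) \<Rightarrow> real \<Rightarrow> bool" where
  "stratonovich_integrable U V T \<longleftrightarrow> (\<exists>I. has_stratonovich_integral U V T I)"

definition stratonovich_integral ::
  "(real \<Rightarrow> real) \<Rightarrow> (real \<Rightarrow> real) \<Rightarrow> real \<Rightarrow> real" where
  "stratonovich_integral U V T = (THE I. has_stratonovich_integral U V T I)"

end

theory Submission
  imports Defs
begin

text \<open>The argument is pathwise. Fix a path \<open>y\<close> of \<open>Y\<close>, a path \<open>b\<close> of \<open>B\<close>, and a
  time \<open>T\<close> up to the hitting time, and let \<open>F\<close> be the integral of the drift \<open>k / y - a y\<close> from zero.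
  The equation says that \<open>\<sigma>/2 b\<close> equals \<open>y - F/2\<close> up to a constant. Stratonovich sums are linear in
  the integrator, so \<open>y\<close> has to be integrated against \<open>y\<close> and against \<open>F\<close>. The sums of the first
  kind telescope exactly to half of the increment of \<open>y\<^sup>2\<close> (\<open>has_stratonovich_integral_self\<close>); those of
  the second kind converge to the integral of \<open>y (k / y - a y) = k - a y\<^sup>2\<close>
  (\<open>has_stratonovich_integral_indefinite\<close>). Multiplying out gives the equation for \<open>X = y\<^sup>2\<close>, and
  \<open>y\<close> is the square root of \<open>X\<close>.

  The delicate case is \<open>T\<close> equal to the hitting time, where \<open>k / y\<close> may explode and the equation for
  \<open>Y\<close> is given only before \<open>T\<close>. But the equation itself bounds the integrals of the drift by the
  continuous paths \<open>y\<close> and \<open>b\<close>, and \<open>k / y\<close> has a constant sign; hence the drift is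
  absolutely integrable up to \<open>T\<close> (\<open>drift_absolutely_integrable\<close>). This yields both the convergence
  of the second kind of sums and, by continuity, the equation at \<open>T\<close>.\<close>

section \<open>Partitions and Stratonovich sums\<close>

lemma partition_mono:
  assumes "is_partition T n p" and "i \<le> j" and "j \<le> n"
  shows "p i \<le> p j"
  using assms(2,3)
proof (induction j rule: dec_induct)
  case (step j)
  then have "p j < p (Suc j)"
    using assms(1) by (auto simp: is_partition_def)
  then show ?case
    using step by auto
qed simp

lemma partition_range:
  assumes "is_partition T n p" and "i \<le> n"
  shows "p i \<in> {0..T}"
  using partition_mono[OF assms(1), of 0 i] partition_mono[OF assms(1), of i n] assms
  by (auto simp: is_partition_def)

text \<open>Without arbitrarily fine partitions every number would be a limit of the Stratonovich sums;
  this is what makes the integral unique. At \<open>T = 0\<close> the witness is the empty partition.\<close>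

lemma fine_partition_exists:
  assumes "0 \<le> T" and "0 < \<delta>"
  obtains n p where "is_partition T n p" and "\<forall>i<n. p (Suc i) - p i < \<delta>"
proof (cases "T = 0")
  case True
  then have "is_partition T 0 (\<lambda>_. 0)"
    by (simp add: is_partition_def)
  then show ?thesis
    using that by blast
next
  case False
  obtain n :: nat where n: "T / \<delta> < real n"
    using reals_Archimedean2 by blast
  with assms have "0 < T / \<delta>" "0 < T"
    using False by auto
  with n have "0 < n"
    by (cases n) auto
  have step: "real (Suc i) * T / n - real i * T / n = T / n" for i
    by (simp add: distrib_right add_divide_distrib)
  have "T / n < \<delta>"
    using n \<open>0 < n\<close> assms by (simp add: field_simps)
  moreover have "is_partition T n (\<lambda>i. real i * T / n)"
    using \<open>0 < n\<close> \<open>0 < T\<close> by (simp add: is_partition_def divide_strict_right_mono)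
  ultimately show ?thesis
    using that step by metis
qed

definition stratonovich_sum ::
  "(real \<Rightarrow> real) \<Rightarrow> (real \<Rightarrow> real) \<Rightarrow> nat \<Rightarrow> (nat \<Rightarrow> real) \<Rightarrow> real" where
  "stratonovich_sum U V n p =
     (\<Sum>i<n. (U (p (Suc i)) + U (p i)) / 2 * (V (p (Suc i)) - V (p i)))"

lemma has_stratonovich_integral_iff:
  "has_stratonovich_integral U V T I \<longleftrightarrow>
     (\<forall>\<epsilon>>0. \<exists>\<delta>>0. \<forall>n p. is_partition T n p \<longrightarrow> (\<forall>i<n. p (Suc i) - p i < \<delta>) \<longrightarrow>
        \<bar>stratonovich_sum U V n p - I\<bar> < \<epsilon>)"
proof -
  have "(\<Sum>i=1..n. (U (p i) + U (p (i - 1))) / 2 * (V (p i) - V (p (i - 1))))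
      = stratonovich_sum U V n p" for n p
    unfolding stratonovich_sum_def One_nat_def sum.atLeast1_atMost_eq by simp
  then show ?thesis
    unfolding has_stratonovich_integral_def by simp
qed

lemma has_stratonovich_integralD:
  assumes "has_stratonovich_integral U V T I" and "0 < \<epsilon>"
  obtains \<delta> where "0 < \<delta>"
    and "\<And>n p. is_partition T n p \<Longrightarrow> \<forall>i<n. p (Suc i) - p i < \<delta> \<Longrightarrow>
           \<bar>stratonovich_sum U V n p - I\<bar> < \<epsilon>"
  using assms unfolding has_stratonovich_integral_iff by meson

section \<open>Elementary properties of the Stratonovich integral\<close>

lemma has_stratonovich_integral_unique:
  assumes "0 \<le> T" and I: "has_stratonovich_integral U V T I"
    and J: "has_stratonovich_integral U V T J"
  shows "I = J"
proof (rule ccontr)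
  assume "I \<noteq> J"
  then have e: "0 < \<bar>I - J\<bar> / 2"
    by simp
  obtain d where d: "0 < d"
    "\<And>n p. is_partition T n p \<Longrightarrow> \<forall>i<n. p (Suc i) - p i < d \<Longrightarrow>
       \<bar>stratonovich_sum U V n p - I\<bar> < \<bar>I - J\<bar> / 2"
    using has_stratonovich_integralD[OF I e] by blast
  obtain d' where d': "0 < d'"
    "\<And>n p. is_partition T n p \<Longrightarrow> \<forall>i<n. p (Suc i) - p i < d' \<Longrightarrow>
       \<bar>stratonovich_sum U V n p - J\<bar> < \<bar>I - J\<bar> / 2"
    using has_stratonovich_integralD[OF J e] by blast
  obtain n p where p: "is_partition T n p" "\<forall>i<n. p (Suc i) - p i < min d d'"
    using fine_partition_exists[of T "min d d'"] assms(1) d(1) d'(1) by auto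
  show False
    using d(2)[OF p(1)] d'(2)[OF p(1)] p(2) \<open>I \<noteq> J\<close> by (simp add: abs_if split: if_splits)
qed

lemma stratonovich_integral_eq:
  assumes "0 \<le> T" and "has_stratonovich_integral U V T I"
  shows "stratonovich_integral U V T = I"
  unfolding stratonovich_integral_def
  using assms has_stratonovich_integral_unique by blast

lemma has_stratonovich_integral_cong:
  assumes "\<And>s. s \<in> {0..T} \<Longrightarrow> U s = U' s" and "\<And>s. s \<in> {0..T} \<Longrightarrow> V s = V' s"
  shows "has_stratonovich_integral U V T I \<longleftrightarrow> has_stratonovich_integral U' V' T I"
proof -
  have "stratonovich_sum U V n p = stratonovich_sum U' V' n p" if "is_partition T n p" for n p
    unfolding stratonovich_sum_def
    using assms partition_range[OF that] by (intro sum.cong) auto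
  then show ?thesis
    unfolding has_stratonovich_integral_iff by metis
qed

lemma has_stratonovich_integral_diff:
  assumes V: "has_stratonovich_integral U V T I" and W: "has_stratonovich_integral U W T J"
  shows "has_stratonovich_integral U (\<lambda>s. V s - W s) T (I - J)"
  unfolding has_stratonovich_integral_iff
proof (intro allI impI)
  fix \<epsilon> :: real
  assume "0 < \<epsilon>"
  then have e: "0 < \<epsilon> / 2"
    by simp
  obtain d where d: "0 < d"
    "\<And>n p. is_partition T n p \<Longrightarrow> \<forall>i<n. p (Suc i) - p i < d \<Longrightarrow>
       \<bar>stratonovich_sum U V n p - I\<bar> < \<epsilon> / 2"
    using has_stratonovich_integralD[OF V e] by blast
  obtain d' where d': "0 < d'"
    "\<And>n p. is_partition T n p \<Longrightarrow> \<forall>i<n. p (Suc i) - p i < d' \<Longrightarrow>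
       \<bar>stratonovich_sum U W n p - J\<bar> < \<epsilon> / 2"
    using has_stratonovich_integralD[OF W e] by blast
  have "\<bar>stratonovich_sum U (\<lambda>s. V s - W s) n p - (I - J)\<bar> < \<epsilon>"
    if p: "is_partition T n p" "\<forall>i<n. p (Suc i) - p i < min d d'" for n p
  proof -
    have "stratonovich_sum U (\<lambda>s. V s - W s) n p
        = stratonovich_sum U V n p - stratonovich_sum U W n p"
      unfolding stratonovich_sum_def sum_subtractf[symmetric]
      by (intro sum.cong) (auto simp: field_simps)
    moreover have "\<bar>stratonovich_sum U V n p - I\<bar> < \<epsilon> / 2"
      using d(2)[OF p(1)] p(2) by simp
    moreover have "\<bar>stratonovich_sum U W n p - J\<bar> < \<epsilon> / 2"
      using d'(2)[OF p(1)] p(2) by simp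
    ultimately show ?thesis
      by argo
  qed
  then show "\<exists>\<delta>>0. \<forall>n p. is_partition T n p \<longrightarrow> (\<forall>i<n. p (Suc i) - p i < \<delta>) \<longrightarrow>
      \<bar>stratonovich_sum U (\<lambda>s. V s - W s) n p - (I - J)\<bar> < \<epsilon>"
    using d(1) d'(1) by (intro exI[of _ "min d d'"]) auto
qed

lemma has_stratonovich_integral_affine:
  assumes V: "has_stratonovich_integral U V T I"
  shows "has_stratonovich_integral U (\<lambda>s. c * (V s - b)) T (c * I)"
  unfolding has_stratonovich_integral_iff
proof (intro allI impI)
  fix \<epsilon> :: real
  assume "0 < \<epsilon>"
  then have "0 < \<epsilon> / (\<bar>c\<bar> + 1)"
    by (simp add: add_nonneg_pos)
  from has_stratonovich_integralD[OF V this] obtain d where d: "0 < d"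
    "\<And>n p. is_partition T n p \<Longrightarrow> \<forall>i<n. p (Suc i) - p i < d \<Longrightarrow>
       \<bar>stratonovich_sum U V n p - I\<bar> < \<epsilon> / (\<bar>c\<bar> + 1)"
    by blast
  have "\<bar>stratonovich_sum U (\<lambda>s. c * (V s - b)) n p - c * I\<bar> < \<epsilon>"
    if p: "is_partition T n p" "\<forall>i<n. p (Suc i) - p i < d" for n p
  proof -
    have "stratonovich_sum U (\<lambda>s. c * (V s - b)) n p = c * stratonovich_sum U V n p"
      unfolding stratonovich_sum_def sum_distrib_left by (simp add: algebra_simps)
    then have "\<bar>stratonovich_sum U (\<lambda>s. c * (V s - b)) n p - c * I\<bar>
        = \<bar>c\<bar> * \<bar>stratonovich_sum U V n p - I\<bar>"
      by (simp add: abs_mult flip: right_diff_distrib)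
    also have "\<dots> \<le> (\<bar>c\<bar> + 1) * \<bar>stratonovich_sum U V n p - I\<bar>"
      by (intro mult_right_mono) auto
    also have "\<dots> < \<epsilon>"
      using d(2)[OF p] by (simp add: field_simps)
    finally show ?thesis .
  qed
  then show "\<exists>\<delta>>0. \<forall>n p. is_partition T n p \<longrightarrow> (\<forall>i<n. p (Suc i) - p i < \<delta>) \<longrightarrow>
      \<bar>stratonovich_sum U (\<lambda>s. c * (V s - b)) n p - c * I\<bar> < \<epsilon>"
    using d(1) by blast
qed

text \<open>The symmetric weights make the chain rule for the square exact, whatever the roughness of the
  path: each summand is half of an increment of \<open>U\<^sup>2\<close>, so every Stratonovich sum telescopes to the
  same value and no quadratic variation appears.\<close>

lemma has_stratonovich_integral_self:
  "has_stratonovich_integral U U T (((U T)\<^sup>2 - (U 0)\<^sup>2) / 2)"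
proof -
  have "stratonovich_sum U U n p = ((U T)\<^sup>2 - (U 0)\<^sup>2) / 2" if p: "is_partition T n p" for n p
  proof -
    have "stratonovich_sum U U n p = (\<Sum>i<n. (U (p (Suc i)))\<^sup>2 / 2 - (U (p i))\<^sup>2 / 2)"
      unfolding stratonovich_sum_def
      by (intro sum.cong) (auto simp: power2_eq_square field_simps)
    also have "\<dots> = (U (p n))\<^sup>2 / 2 - (U (p 0))\<^sup>2 / 2"
      by (rule sum_lessThan_telescope)
    finally show ?thesis
      using p by (simp add: is_partition_def diff_divide_distrib)
  qed
  then show ?thesis
    unfolding has_stratonovich_integral_iff by (metis abs_zero diff_self zero_less_one)
qed

section \<open>Integration against an indefinite integral\<close>

lemma indefinite_integral_diff:
  fixes g :: "real \<Rightarrow> real"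
  assumes "g integrable_on {0..T}" and "0 \<le> u" and "u \<le> v" and "v \<le> T"
  shows "integral {0..v} g - integral {0..u} g = integral {u..v} g"
proof -
  have "g integrable_on {0..v}"
    using assms by (auto intro: integrable_on_subinterval)
  then show ?thesis
    using Henstock_Kurzweil_Integration.integral_combine[of 0 u v g] assms by simp
qed

lemma sum_integral_partition:
  fixes g :: "real \<Rightarrow> real"
  assumes "is_partition T n p" and "g integrable_on {0..T}"
  shows "(\<Sum>i<n. integral {p i..p (Suc i)} g) = integral {0..T} g"
proof -
  have "(\<Sum>i<n. integral {p i..p (Suc i)} g)
      = (\<Sum>i<n. integral {0..p (Suc i)} g - integral {0..p i} g)"
    using partition_range[OF assms(1)] partition_mono[OF assms(1)]
    by (intro sum.cong indefinite_integral_diff[OF assms(2), symmetric] refl) auto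
  also have "\<dots> = integral {0..p n} g - integral {0..p 0} g"
    by (rule sum_lessThan_telescope)
  finally show ?thesis
    using assms(1) by (simp add: is_partition_def)
qed

lemma absolutely_integrable_continuous_mult:
  fixes U f :: "real \<Rightarrow> real"
  assumes "continuous_on {a..b} U" and "f absolutely_integrable_on {a..b}"
  shows "(\<lambda>s. U s * f s) absolutely_integrable_on {a..b}"
  using assms
  by (intro absolutely_integrable_bounded_measurable_product_real
      continuous_imp_measurable_on_sets_lebesgue compact_imp_bounded
      compact_continuous_image) auto

text \<open>An indefinite integral of an absolutely integrable \<open>f\<close> has bounded variation, at most
  the integral of \<open>\<bar>f\<bar>\<close>, so a Stratonovich sum differs from the integral of \<open>U f\<close> by no more than the
  oscillation of \<open>U\<close> over the mesh times that variation. The estimate sees \<open>f\<close> only through its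
  \<open>L\<^sup>1\<close> norm and so covers a drift that explodes at the right endpoint.\<close>

lemma has_stratonovich_integral_indefinite:
  fixes U f :: "real \<Rightarrow> real"
  assumes U: "continuous_on {0..T} U" and f: "f absolutely_integrable_on {0..T}"
  shows "has_stratonovich_integral U (\<lambda>s. integral {0..s} f) T (integral {0..T} (\<lambda>s. U s * f s))"
  unfolding has_stratonovich_integral_iff
proof (intro allI impI)
  fix \<epsilon> :: real
  assume "0 < \<epsilon>"
  define K where "K = integral {0..T} (\<lambda>s. \<bar>f s\<bar>)"
  define \<eta> where "\<eta> = \<epsilon> / (K + 1)"
  have fi: "f integrable_on {0..T}" and afi: "(\<lambda>s. \<bar>f s\<bar>) integrable_on {0..T}"
    and Ufi: "(\<lambda>s. U s * f s) integrable_on {0..T}"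
    using f absolutely_integrable_continuous_mult[OF U f]
    by (auto simp: absolutely_integrable_on_def)
  have "0 \<le> K"
    unfolding K_def by (rule integral_nonneg[OF afi]) auto
  then have "0 < \<eta>" "\<eta> * K < \<epsilon>"
    using \<open>0 < \<epsilon>\<close> by (auto simp: \<eta>_def field_simps)
  have "uniformly_continuous_on {0..T} U"
    using U by (rule compact_uniformly_continuous) simp
  then obtain \<delta> where "0 < \<delta>" and
    \<delta>: "\<And>x x'. x \<in> {0..T} \<Longrightarrow> x' \<in> {0..T} \<Longrightarrow> dist x' x < \<delta> \<Longrightarrow> dist (U x') (U x) < \<eta>"
    using \<open>0 < \<eta>\<close> unfolding uniformly_continuous_on_def by meson
  have "\<bar>stratonovich_sum U (\<lambda>s. integral {0..s} f) n p - integral {0..T} (\<lambda>s. U s * f s)\<bar> < \<epsilon>"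
    if p: "is_partition T n p" and mesh: "\<forall>i<n. p (Suc i) - p i < \<delta>" for n p
  proof -
    have cell: "\<bar>(U (p (Suc i)) + U (p i)) / 2 * (integral {0..p (Suc i)} f - integral {0..p i} f)
          - integral {p i..p (Suc i)} (\<lambda>s. U s * f s)\<bar>
        \<le> \<eta> * integral {p i..p (Suc i)} (\<lambda>s. \<bar>f s\<bar>)" if "i < n" for i
    proof -
      define m where "m = (U (p (Suc i)) + U (p i)) / 2"
      have pi: "p i \<in> {0..T}" "p (Suc i) \<in> {0..T}" "p i \<le> p (Suc i)"
        using partition_range[OF p] partition_mono[OF p] that by auto
      have sub: "{p i..p (Suc i)} \<subseteq> {0..T}"
        using pi by auto
      note ints = integrable_on_subinterval[OF fi sub] integrable_on_subinterval[OF afi sub]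
        integrable_on_subinterval[OF Ufi sub]
      have osc: "\<bar>m - U s\<bar> \<le> \<eta>" if s: "s \<in> {p i..p (Suc i)}" for s
      proof -
        have "s \<in> {0..T}" "dist s (p i) < \<delta>" "dist s (p (Suc i)) < \<delta>"
          using s sub mesh \<open>i < n\<close> by (fastforce simp: dist_real_def)+
        then have "dist (U s) (U (p i)) < \<eta>" "dist (U s) (U (p (Suc i))) < \<eta>"
          using \<delta> pi by blast+
        then show ?thesis
          unfolding m_def dist_real_def by argo
      qed
      have "m * (integral {0..p (Suc i)} f - integral {0..p i} f)
          - integral {p i..p (Suc i)} (\<lambda>s. U s * f s)
          = integral {p i..p (Suc i)} (\<lambda>s. m * f s - U s * f s)"
        using indefinite_integral_diff[OF fi, of "p i" "p (Suc i)"] pi ints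
        by (simp add: integral_diff integrable_on_mult_right)
      also have "\<bar>\<dots>\<bar> \<le> integral {p i..p (Suc i)} (\<lambda>s. \<eta> * \<bar>f s\<bar>)"
        unfolding real_norm_def[symmetric]
      proof (rule Henstock_Kurzweil_Integration.integral_norm_bound_integral)
        fix s
        assume "s \<in> {p i..p (Suc i)}"
        from osc[OF this] show "norm (m * f s - U s * f s) \<le> \<eta> * norm (f s)"
          by (simp add: abs_mult mult_right_mono flip: left_diff_distrib)
      qed (use ints in \<open>auto intro!: integrable_diff integrable_on_mult_right\<close>)
      finally show ?thesis
        using ints by (simp add: m_def)
    qed
    have "\<bar>stratonovich_sum U (\<lambda>s. integral {0..s} f) n p - integral {0..T} (\<lambda>s. U s * f s)\<bar>
        = \<bar>\<Sum>i<n. (U (p (Suc i)) + U (p i)) / 2 * (integral {0..p (Suc i)} f - integral {0..p i} f)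
            - integral {p i..p (Suc i)} (\<lambda>s. U s * f s)\<bar>"
      by (simp add: stratonovich_sum_def sum_subtractf flip: sum_integral_partition[OF p Ufi])
    also have "\<dots> \<le> (\<Sum>i<n. \<eta> * integral {p i..p (Suc i)} (\<lambda>s. \<bar>f s\<bar>))"
      by (rule order_trans[OF sum_abs sum_mono]) (use cell in auto)
    also have "\<dots> = \<eta> * K"
      by (simp add: K_def flip: sum_distrib_left sum_integral_partition[OF p afi])
    also have "\<dots> < \<epsilon>"
      by fact
    finally show ?thesis .
  qed
  then show "\<exists>\<delta>>0. \<forall>n p. is_partition T n p \<longrightarrow> (\<forall>i<n. p (Suc i) - p i < \<delta>) \<longrightarrow>
      \<bar>stratonovich_sum U (\<lambda>s. integral {0..s} f) n p - integral {0..T} (\<lambda>s. U s * f s)\<bar> < \<epsilon>"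
    using \<open>0 < \<delta>\<close> by blast
qed

section \<open>The equation for a single path, up to and including the hitting time\<close>

text \<open>The singular drift \<open>k / y\<close> may blow up at \<open>T\<close>, but it has the constant sign of \<open>k\<close>, while the
  equation expresses its integral over compact subintervals through the bounded paths \<open>y\<close> and
  \<open>b\<close>. A function whose integrals over these subintervals are bounded, and which is bounded on
  one side by an integrable function (here \<open>- a y\<close>), is absolutely integrable.\<close>

lemma drift_absolutely_integrable:
  fixes y b :: "real \<Rightarrow> real"
  assumes y: "continuous_on {0..T} y" and b: "continuous_on {0..T} b"
    and pos: "\<And>s. s \<in> {0..<T} \<Longrightarrow> 0 < y s" and end_nonneg: "0 \<le> y T"
    and eq: "\<And>s. s \<in> {0..<T} \<Longrightarrow>
      y s = y 0 + 1/2 * integral {0..s} (\<lambda>r. k / y r - a * y r) + c * b s"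
  shows "(\<lambda>r. k / y r - a * y r) absolutely_integrable_on {0..T}"
proof -
  define f where "f = (\<lambda>r. k / y r - a * y r)"
  define G where "G = (\<lambda>s. 2 * (y s - y 0 - c * b s))"
  have G: "integral {0..s} f = G s" if "s \<in> {0..<T}" for s
    using eq[OF that] by (simp add: f_def G_def)
  have int0: "f integrable_on {0..v}" if "v < T" for v
    unfolding f_def using that
    by (intro integrable_continuous_interval continuous_intros continuous_on_subset[OF y])
      (use pos in \<open>force+\<close>)
  have "continuous_on {0..T} G"
    unfolding G_def by (intro continuous_intros y b)
  then have "bounded (G ` {0..T})"
    by (intro compact_imp_bounded compact_continuous_image) auto
  then obtain C where C: "\<And>s. s \<in> {0..T} \<Longrightarrow> \<bar>G s\<bar> \<le> C"
    unfolding bounded_iff by force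
  have cells: "u \<in> {0..<T} \<and> v \<in> {0..<T}" if "{u..v} \<subseteq> {0<..<T}" "u \<le> v" for u v :: real
    using that by (auto simp: subset_iff)
  have "f absolutely_integrable_on cbox 0 T"
  proof (rule absolutely_integrable_improper)
    fix u v :: real
    assume "cbox u v \<subseteq> box 0 T"
    then show "f integrable_on cbox u v"
      using cells[of u v] int0[of v]
      by (cases "u \<le> v") (auto intro: integrable_on_subinterval)
  next
    have "\<bar>integral {u..v} f\<bar> \<le> 2 * \<bar>C\<bar>" if "{u..v} \<subseteq> {0<..<T}" for u v
    proof (cases "u \<le> v")
      case True
      with cells[OF that] have uv: "u \<in> {0..<T}" "v \<in> {0..<T}"
        by auto
      then have "integral {u..v} f = G v - G u"
        using indefinite_integral_diff[OF int0, of v u v] True G by simp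
      then show ?thesis
        using C[of u] C[of v] uv by auto
    qed auto
    then show "bounded {integral (cbox u v) f |u v. cbox u v \<subseteq> box 0 T}"
      unfolding bounded_iff by auto
  next
    fix i :: real
    assume "i \<in> Basis"
    have lin: "(\<lambda>r. - a * y r) absolutely_integrable_on cbox 0 T"
      unfolding box_real by (intro absolutely_integrable_continuous_real continuous_intros y)
    have nn: "0 \<le> y r" if "r \<in> {0..T}" for r
      using that pos[of r] end_nonneg by (cases "r = T") auto
    have "(\<forall>r\<in>cbox 0 T. f r \<ge> - a * y r) \<or> (\<forall>r\<in>cbox 0 T. f r \<le> - a * y r)"
      using nn by (cases "0 \<le> k") (auto simp: f_def divide_nonpos_nonneg)
    then show "\<exists>g. g absolutely_integrable_on cbox 0 T \<and>
        ((\<forall>x\<in>cbox 0 T. f x \<bullet> i \<le> g x) \<or> (\<forall>x\<in>cbox 0 T. f x \<bullet> i \<ge> g x))"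
      using lin \<open>i \<in> Basis\<close> by auto
  qed
  then show ?thesis
    by (simp add: f_def)
qed

text \<open>Solving the equation for \<open>b\<close> writes the integrator as a combination of \<open>y\<close> itself, where the
  chain rule for the square applies, and of the integrated drift. The equation is known strictly
  before \<open>T\<close> only; since the drift is integrable up to \<open>T\<close>, both sides are continuous on the closed
  interval and the equation survives at the endpoint. There the drift multiplied by \<open>y\<close> may differ
  from \<open>k - a y\<^sup>2\<close>, but a single point does not change the integral.\<close>

lemma has_stratonovich_integral_solution:
  fixes y b :: "real \<Rightarrow> real"
  assumes "0 \<le> T" and "0 < \<sigma>" and "b 0 = 0"
    and y: "continuous_on {0..T} y" and b: "continuous_on {0..T} b"
    and pos: "\<And>s. s \<in> {0..<T} \<Longrightarrow> 0 < y s" and end_nonneg: "0 \<le> y T"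
    and eq: "\<And>s. s \<in> {0..<T} \<Longrightarrow>
      y s = y 0 + 1/2 * integral {0..s} (\<lambda>r. k / y r - a * y r) + \<sigma>/2 * b s"
  shows "has_stratonovich_integral y b T
    (((y T)\<^sup>2 - (y 0)\<^sup>2 - integral {0..T} (\<lambda>s. k - a * (y s)\<^sup>2)) / \<sigma>)"
proof -
  define f where "f = (\<lambda>r. k / y r - a * y r)"
  define F where "F = (\<lambda>s. integral {0..s} f)"
  define J where "J = integral {0..T} (\<lambda>s. k - a * (y s)\<^sup>2)"
  have f: "f absolutely_integrable_on {0..T}"
    unfolding f_def using drift_absolutely_integrable[OF y b pos end_nonneg eq] .
  then have "continuous_on {0..T} F"
    unfolding F_def
    by (intro indefinite_integral_continuous_1) (simp add: absolutely_integrable_on_def)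
  then have cont: "continuous_on {0..T} (\<lambda>s. y s - 1/2 * F s - \<sigma>/2 * b s)"
    by (intro continuous_intros y b)
  have closed_eq: "y s - 1/2 * F s - \<sigma>/2 * b s = y 0" if s: "s \<in> {0..T}" for s
  proof (cases "T = 0")
    case True
    then show ?thesis
      using s \<open>b 0 = 0\<close> by (simp add: F_def)
  next
    case False
    then have cl: "closure {0..<T} = {0..T}"
      using \<open>0 \<le> T\<close> by (intro closure_atLeastLessThan) auto
    have "y r - 1/2 * F r - \<sigma>/2 * b r = y 0" if "r \<in> {0..<T}" for r
      using eq[OF that] by (simp add: F_def f_def)
    then show ?thesis
      using continuous_constant_on_closure[of "{0..<T}" "\<lambda>s. y s - 1/2 * F s - \<sigma>/2 * b s" "y 0" s]
        cont s unfolding cl by blast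
  qed
  have "integral {0..T} (\<lambda>s. y s * f s) = J"
    unfolding J_def
  proof (rule integral_spike[of "{T}"])
    fix s
    assume "s \<in> {0..T} - {T}"
    then have "0 < y s"
      using pos by auto
    then show "k - a * (y s)\<^sup>2 = y s * f s"
      by (simp add: f_def field_simps power2_eq_square)
  qed simp
  then have "has_stratonovich_integral y F T J"
    using has_stratonovich_integral_indefinite[OF y f] by (simp add: F_def)
  from has_stratonovich_integral_diff[OF has_stratonovich_integral_self
      has_stratonovich_integral_affine[OF this, of "1/2" 0]]
  have "has_stratonovich_integral y (\<lambda>s. 2/\<sigma> * (y s - 1/2 * (F s - 0) - y 0)) T
      (2/\<sigma> * (((y T)\<^sup>2 - (y 0)\<^sup>2) / 2 - 1/2 * J))"
    by (rule has_stratonovich_integral_affine)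
  moreover have "2/\<sigma> * (y s - 1/2 * (F s - 0) - y 0) = b s" if "s \<in> {0..T}" for s
    using closed_eq[OF that] \<open>0 < \<sigma>\<close> by (simp add: field_simps)
  ultimately have "has_stratonovich_integral y b T (2/\<sigma> * (((y T)\<^sup>2 - (y 0)\<^sup>2) / 2 - 1/2 * J))"
    using has_stratonovich_integral_cong[of T y y
        "\<lambda>s. 2/\<sigma> * (y s - 1/2 * (F s - 0) - y 0)" b] by blast
  also have "2/\<sigma> * (((y T)\<^sup>2 - (y 0)\<^sup>2) / 2 - 1/2 * J) = ((y T)\<^sup>2 - (y 0)\<^sup>2 - J) / \<sigma>"
    using \<open>0 < \<sigma>\<close> by (simp add: field_simps)
  finally show ?thesis
    by (simp add: J_def)
qed

text \<open>The zeros of a continuous path form a closed set, so a time that is not a zero and not after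
  the hitting time lies strictly before it. For a path that starts away from zero this
  gives, at \<open>t = 0\<close>, that the hitting time is positive; at the hitting time itself, that the path vanishes there.\<close>

lemma less_zero_hitting_time:
  assumes cont: "continuous_on {0..} (\<lambda>t. Y t \<omega>)"
    and "0 \<le> t" and "Y t \<omega> \<noteq> 0" and le: "ereal t \<le> zero_hitting_time Y \<omega>"
  shows "ereal t < zero_hitting_time Y \<omega>"
proof -
  have "0 < \<bar>Y t \<omega>\<bar>"
    using assms by simp
  then obtain d where "0 < d" and
    d: "\<And>s. 0 \<le> s \<Longrightarrow> dist s t < d \<Longrightarrow> dist (Y s \<omega>) (Y t \<omega>) < \<bar>Y t \<omega>\<bar>"
    using cont \<open>0 \<le> t\<close> unfolding continuous_on_iff by (metis atLeast_iff)
  have "t + d \<le> s" if s: "0 < s" "Y s \<omega> = 0" for s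
  proof -
    have "zero_hitting_time Y \<omega> \<le> ereal s"
      unfolding zero_hitting_time_def using s by (intro Inf_lower) auto
    with le have "ereal t \<le> ereal s"
      by (rule order_trans)
    then show ?thesis
      using d[of s] s by (force simp: dist_real_def)
  qed
  then have "ereal (t + d) \<le> zero_hitting_time Y \<omega>"
    unfolding zero_hitting_time_def by (intro Inf_greatest) auto
  moreover have "ereal t < ereal (t + d)"
    using \<open>0 < d\<close> by simp
  ultimately show ?thesis
    by (rule less_le_trans[rotated])
qed

theorem theorem1:
  fixes M :: "'a measure" and H a k \<sigma> y\<^sub>0 :: real
    and B Y X :: "real \<Rightarrow> 'a \<Rightarrow> real" and \<tau> :: "'a \<Rightarrow> ereal"
  assumes "0 < H" and "H < 1" and "0 < \<sigma>" and "0 < y\<^sub>0"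
    and "fractional_brownian_motion M H B"
    and "solves_until_zero M k a \<sigma> y\<^sub>0 B Y"
    and "\<tau> = zero_hitting_time Y"
    and "X = fractional_CIR Y"
  shows "\<forall>\<omega>\<in>space M.
    X 0 \<omega> = y\<^sub>0\<^sup>2 \<and> 0 < X 0 \<omega> \<and>
    (\<forall>t\<ge>0. ereal t \<le> \<tau> \<omega> \<longrightarrow>
      stratonovich_integrable (\<lambda>s. sqrt (X s \<omega>)) (\<lambda>s. B s \<omega>) t \<and>
      X t \<omega> = X 0 \<omega> + integral {0..t} (\<lambda>s. k - a * X s \<omega>)
        + \<sigma> * stratonovich_integral (\<lambda>s. sqrt (X s \<omega>)) (\<lambda>s. B s \<omega>) t)"
proof (intro ballI conjI allI impI)
  fix \<omega>
  assume \<omega>: "\<omega> \<in> space M"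
  define y where "y = (\<lambda>t. Y t \<omega>)"
  define b where "b = (\<lambda>t. B t \<omega>)"
  have B: "b 0 = 0" "continuous_on {0..} b"
    using assms(5) \<omega> by (auto simp: fractional_brownian_motion_def b_def)
  have Y: "y 0 = y\<^sub>0" "continuous_on {0..} y"
    and pos: "\<And>t. 0 \<le> t \<Longrightarrow> ereal t < \<tau> \<omega> \<Longrightarrow> 0 < y t"
    and eq: "\<And>t. 0 \<le> t \<Longrightarrow> ereal t < \<tau> \<omega> \<Longrightarrow>
      y t = y 0 + 1/2 * integral {0..t} (\<lambda>s. k / y s - a * y s) + \<sigma>/2 * b t"
    using assms(6) \<omega> unfolding solves_until_zero_def y_def b_def assms(7) by blast+
  \<comment> \<open>Read contrapositively: at the hitting time the path vanishes, so \<open>X = y\<^sup>2\<close> also holds there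
    although the indicator in \<open>X\<close> is zero.\<close>
  have before: "ereal t < \<tau> \<omega>" if "0 \<le> t" "ereal t \<le> \<tau> \<omega>" "y t \<noteq> 0" for t
    using less_zero_hitting_time[of Y \<omega> t] that Y(2) by (simp add: y_def assms(7))
  have "0 \<le> \<tau> \<omega>"
    unfolding assms(7) zero_hitting_time_def by (intro Inf_greatest) auto
  then have "0 < \<tau> \<omega>"
    using before[of 0] Y(1) \<open>0 < y\<^sub>0\<close> by (simp add: zero_ereal_def)
  then show X0: "X 0 \<omega> = y\<^sub>0\<^sup>2"
    using Y(1) by (simp add: assms(7,8) fractional_CIR_def y_def flip: zero_ereal_def)
  then show "0 < X 0 \<omega>"
    using \<open>0 < y\<^sub>0\<close> by simp
  fix t :: real
  assume t: "0 \<le> t" "ereal t \<le> \<tau> \<omega>"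
  have X: "X s \<omega> = (y s)\<^sup>2 \<and> 0 \<le> y s" if "s \<in> {0..t}" for s
  proof -
    have "ereal s \<le> \<tau> \<omega>"
      using that t(2) by (auto intro: order_trans[of _ "ereal t"])
    then have "y s = 0" if "\<not> ereal s < \<tau> \<omega>"
      using before[of s] \<open>s \<in> {0..t}\<close> that by auto
    then show ?thesis
      using pos[of s] that
      by (cases "ereal s < \<tau> \<omega>")
        (simp_all add: assms(7,8) fractional_CIR_def y_def less_imp_le)
  qed
  have less: "ereal s < \<tau> \<omega>" if "s \<in> {0..<t}" for s
    using that t(2) by (auto intro: less_le_trans[of _ "ereal t"])
  have "has_stratonovich_integral y b t
      (((y t)\<^sup>2 - (y 0)\<^sup>2 - integral {0..t} (\<lambda>s. k - a * (y s)\<^sup>2)) / \<sigma>)"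
  proof (rule has_stratonovich_integral_solution)
    show "0 \<le> t" "0 < \<sigma>" "b 0 = 0"
      by fact+
    show "continuous_on {0..t} y" "continuous_on {0..t} b"
      using Y(2) B(2) by (auto intro: continuous_on_subset)
    show "0 \<le> y t"
      using X[of t] t(1) by simp
    fix s
    assume "s \<in> {0..<t}"
    then show "0 < y s"
      and "y s = y 0 + 1/2 * integral {0..s} (\<lambda>r. k / y r - a * y r) + \<sigma>/2 * b s"
      using pos[OF _ less] eq[OF _ less] by (metis atLeastLessThan_iff)+
  qed
  also have "integral {0..t} (\<lambda>s. k - a * (y s)\<^sup>2) = integral {0..t} (\<lambda>s. k - a * X s \<omega>)"
    using X by (intro integral_cong) simp
  finally have I: "has_stratonovich_integral (\<lambda>s. sqrt (X s \<omega>)) (\<lambda>s. B s \<omega>) t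
      ((X t \<omega> - X 0 \<omega> - integral {0..t} (\<lambda>s. k - a * X s \<omega>)) / \<sigma>)"
    using X t(1) by (subst has_stratonovich_integral_cong[of t _ y _ b]) (auto simp: b_def)
  then show "stratonovich_integrable (\<lambda>s. sqrt (X s \<omega>)) (\<lambda>s. B s \<omega>) t"
    unfolding stratonovich_integrable_def by blast
  show "X t \<omega> = X 0 \<omega> + integral {0..t} (\<lambda>s. k - a * X s \<omega>)
      + \<sigma> * stratonovich_integral (\<lambda>s. sqrt (X s \<omega>)) (\<lambda>s. B s \<omega>) t"
    using stratonovich_integral_eq[OF t(1) I] \<open>0 < \<sigma>\<close> by simp
qed

end
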